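(* Let $P$ be a transition matrix on a finite state space $\mathcal{X}$ which is irreducible, reversible with respect to its (unique) stationary distribution $\pi$, and all of whose eigenvalues are positive. Then for every starting distribution $\alpha\neq\pi$ on $\mathcal{X}$ and every $y\in\mathcal{X}$, the limit $$\varphi^\alpha_\star(y):=\lim_{t\to\infty}\mathbb{P}_\alpha\left(X_t=y\mid \tau^\alpha_\pi>t\right)$$ exists, where $(X_t)_{t\ge 0}$ is the Markov chain with transition matrix $P$ started from $\alpha$ and $\tau_\pi^\alpha$ is an optimal strong stationary time for the chain started at $\alpha$.
   Context: $(X_t)_{t\ge 0}$ is a discrete-time Markov chain on the finite set $\mathcal{X}$ with transition matrix $P$; $\mathbb{P}_\alpha$ denotes the law of the chain (together with any additional randomness needed to define randomized stopping times) with $X_0\sim\alpha$. All entries of $\pi$ are positive. For a probability distribution $\alpha$ on $\mathcal{X}$ set $$\mu^\alpha_t(y)=\sum_{x\in\mathcal{X}}\alpha(x)P^t(x,y),\qquad s^\alpha_t=\max_{y\in\mathcal{X}}\left(1-\frac{\mu^\alpha_t(y)}{\pi(y)}\right),\qquad t\ge 0$$ ($s_t^\alpha$ is the separation distance from stationarity). An optimal strong stationary time $\tau^\alpha_\pi$ is a randomized stopping time such that $$\mathbb{P}_\alpha(X_t=y,\ \tau^\alpha_\pi\le t)=\pi(y)\,\mathbb{P}_\alpha(\tau^\alpha_\pi\le t)\quad\text{for all } t\ge 0,\ y\in\mathcal{X},$$ and $$\mathbb{P}_\alpha(\tau^\alpha_\pi>t)=s^\alpha_t\quad\text{for all } t\ge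 0.$$ *)

theory Defs
  imports "HOL-Probability.Probability" "HOL-Library.Extended_Nat"
begin

section \<open>Transition matrices\<close>

text \<open>
  The finite state space is a type of class \<^class>\<open>finite\<close>; \<open>P $ x $ y\<close> is the probability of a
  step from \<open>x\<close> to \<open>y\<close>. Probability distributions on the state space are values of type
  \<open>'s pmf\<close>.
\<close>

definition transition_matrix :: "real ^ 's ^ 's \<Rightarrow> bool" where
  "transition_matrix P \<longleftrightarrow> (\<forall>x y. 0 \<le> P $ x $ y) \<and> (\<forall>x. (\<Sum>y\<in>UNIV. P $ x $ y) = 1)"

primrec matrix_power :: "real ^ 's ^ 's \<Rightarrow> nat \<Rightarrow> real ^ 's ^ 's" where
  "matrix_power P 0 = mat 1"
| "matrix_power P (Suc t) = matrix_power P t ** P"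

definition irreducible_chain :: "real ^ 's ^ 's \<Rightarrow> bool" where
  "irreducible_chain P \<longleftrightarrow> (\<forall>x y. \<exists>t. 0 < matrix_power P t $ x $ y)"

definition stationary_distribution :: "real ^ 's ^ 's \<Rightarrow> 's pmf \<Rightarrow> bool" where
  "stationary_distribution P \<pi> \<longleftrightarrow> (\<forall>y. (\<Sum>x\<in>UNIV. pmf \<pi> x * P $ x $ y) = pmf \<pi> y)"

definition reversible_wrt :: "real ^ 's ^ 's \<Rightarrow> 's pmf \<Rightarrow> bool" where
  "reversible_wrt P \<pi> \<longleftrightarrow> (\<forall>x y. pmf \<pi> x * P $ x $ y = pmf \<pi> y * P $ y $ x)"

text \<open>
  Real eigenvalues suffice here: a matrix that is reversible with respect to a positive
  distribution is self-adjoint for the weighted inner product, so it has no other eigenvalues.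
\<close>

definition is_eigenvalue :: "real ^ 's ^ 's \<Rightarrow> real \<Rightarrow> bool" where
  "is_eigenvalue P l \<longleftrightarrow> (\<exists>v. v \<noteq> 0 \<and> P *v v = l *\<^sub>R v)"

definition law_at :: "real ^ 's ^ 's \<Rightarrow> 's pmf \<Rightarrow> nat \<Rightarrow> 's \<Rightarrow> real" where
  "law_at P \<alpha> t y = (\<Sum>x\<in>UNIV. pmf \<alpha> x * matrix_power P t $ x $ y)"

definition separation :: "real ^ 's ^ 's \<Rightarrow> 's pmf \<Rightarrow> 's pmf \<Rightarrow> nat \<Rightarrow> real" where
  "separation P \<pi> \<alpha> t = (MAX y. 1 - law_at P \<alpha> t y / pmf \<pi> y)"

section \<open>Markov chains and randomized stopping times\<close>

text \<open>
  The additional randomness of a randomized stopping time is carried by the filtration \<open>F\<close>,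
  which may be larger than the one generated by \<open>X\<close>, but with respect to which \<open>X\<close> must still
  be a Markov chain with transition matrix \<open>P\<close>. For instance, if
  \<open>X (Suc t) = f (X t) (Z (Suc t))\<close> is driven by i.i.d. \<open>Z\<close>, then \<open>F t\<close> can be generated by
  \<open>X 0\<close>, \<open>Z 1\<close>, \dots, \<open>Z t\<close> and an independent variable.
\<close>

definition markov_chain ::
  "'w measure \<Rightarrow> (nat \<Rightarrow> 'w measure) \<Rightarrow> real ^ 's ^ 's \<Rightarrow> 's pmf \<Rightarrow> (nat \<Rightarrow> 'w \<Rightarrow> 's) \<Rightarrow> bool"
where
  "markov_chain M F P \<alpha> X \<longleftrightarrow>
     prob_space M \<and> filtration (space M) F \<and> (\<forall>t. subalgebra M (F t)) \<and>
     (\<forall>t. X t \<in> F t \<rightarrow>\<^sub>M count_space UNIV) \<and>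
     (\<forall>x. \<P>(\<omega> in M. X 0 \<omega> = x) = pmf \<alpha> x) \<and>
     (\<forall>t y. AE \<omega> in M.
        real_cond_exp M (F t) (indicator {\<omega> \<in> space M. X (Suc t) \<omega> = y}) \<omega> = P $ X t \<omega> $ y)"

text \<open>
  Stopping times may be infinite, while time itself is \<^typ>\<open>nat\<close>; hence the library's
  \<^const>\<open>stopping_time\<close>, whose values are elements of the index type, does not apply.
\<close>

definition randomized_stopping_time :: "(nat \<Rightarrow> 'w measure) \<Rightarrow> ('w \<Rightarrow> enat) \<Rightarrow> bool" where
  "randomized_stopping_time F \<tau> \<longleftrightarrow> (\<forall>t. Measurable.pred (F t) (\<lambda>\<omega>. \<tau> \<omega> \<le> enat t))"

definition optimal_strong_stationary_time ::
  "'w measure \<Rightarrow> (nat \<Rightarrow> 'w measure) \<Rightarrow> real ^ 's ^ 's \<Rightarrow> 's pmf \<Rightarrow> 's pmf \<Rightarrow>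
   (nat \<Rightarrow> 'w \<Rightarrow> 's) \<Rightarrow> ('w \<Rightarrow> enat) \<Rightarrow> bool"
where
  "optimal_strong_stationary_time M F P \<pi> \<alpha> X \<tau> \<longleftrightarrow>
     randomized_stopping_time F \<tau> \<and>
     (\<forall>t y. \<P>(\<omega> in M. X t \<omega> = y \<and> \<tau> \<omega> \<le> enat t) = pmf \<pi> y * \<P>(\<omega> in M. \<tau> \<omega> \<le> enat t)) \<and>
     (\<forall>t. \<P>(\<omega> in M. \<tau> \<omega> > enat t) = separation P \<pi> \<alpha> t)"

end

theory Submission
  imports Defs
begin

text \<open>
  Write \<open>\<mu> t\<close> for the law of the chain at time \<open>t\<close> and \<open>s t\<close> for its separation from \<open>\<pi>\<close>. On the
  event that the strong stationary time has already occurred the chain is distributed according to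
  \<open>\<pi>\<close>, and the complementary event has probability \<open>s t\<close>. Subtracting,
  \<open>P(X t = y, \<tau> > t) = \<mu> t y - \<pi> y * (1 - s t)\<close>, so the conditional probability in question is
  \<open>\<pi> y + (\<mu> t y - \<pi> y) / s t\<close> (\<open>conditional_law_given_not_stopped\<close>). The choice of the optimal
  time and of the extra randomness has disappeared, and what remains is a statement about matrix
  powers: the deviation \<open>\<mu> t - \<pi>\<close>, divided by the separation, converges.

  The separation is itself a function of the deviation, positively homogeneous of degree one and
  continuous. It therefore suffices that the deviation, rescaled by a geometric factor \<open>l ^ t\<close>,
  converges to a limit at which this function does not vanish. By reversibility the deviation,
  divided by \<open>sqrt \<pi>\<close>, evolves by a symmetric matrix with the same eigenvalues as \<open>P\<close>.
  Decompose its initial value into eigenvectors, and let \<open>l\<close> be the largest eigenvalue that occurs.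
  Since all eigenvalues are positive, \<open>l\<close> strictly dominates the others in modulus; a competing
  eigenvalue \<open>-l\<close> would make the rescaled powers oscillate. Hence the rescaled deviation converges
  to its component \<open>g\<close> for \<open>l\<close>, which is nonzero (\<open>power_iteration_converges\<close>).
  Finally, deviations have total mass zero, and so does the limit; being nonzero, it is negative
  somewhere, and so the rescaled separation tends to a strictly positive number
  (\<open>discrepancy_over_separation_converges\<close>).
\<close>

section \<open>Power iteration for self-adjoint operators\<close>

text \<open>
  A maximiser \<open>v\<close> of the Rayleigh quotient over the unit sphere of \<open>W\<close> is an eigenvector: the
  residual \<open>r = f v - l *\<^sub>R v\<close> is, up to a positive factor, the gradient of the quotient within
  \<open>W\<close> at \<open>v\<close>, so a small step in the direction \<open>r\<close> would increase the quotient unless \<open>r = 0\<close>.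
\<close>

lemma selfadjoint_eigenvector_in_invariant_subspace:
  fixes f :: "'a :: euclidean_space \<Rightarrow> 'a"
  assumes lin: "linear f" and sa: "\<And>v w. f v \<bullet> w = v \<bullet> f w"
    and W: "subspace W" and inv: "f ` W \<subseteq> W" and nz: "W \<noteq> {0}"
  obtains l v where "v \<in> W" "v \<noteq> 0" "f v = l *\<^sub>R v"
proof -
  interpret linear f by (rule lin)
  obtain w where w: "w \<in> W" "w \<noteq> 0"
    using nz subspace_0[OF W] by blast
  let ?S = "W \<inter> sphere 0 1"
  have "compact ?S"
    by (intro closed_Int_compact closed_subspace W compact_sphere)
  moreover have "w /\<^sub>R norm w \<in> ?S"
    using w by (auto intro: subspace_scale[OF W])
  moreover have "continuous_on ?S (\<lambda>w. w \<bullet> f w)"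
    by (intro continuous_on_inner continuous_on_id linear_continuous_on)
      (use lin linear_conv_bounded_linear in blast)
  ultimately obtain v where v: "v \<in> ?S" and vmax: "\<And>w. w \<in> ?S \<Longrightarrow> w \<bullet> f w \<le> v \<bullet> f v"
    using continuous_attains_sup[of ?S "\<lambda>w. w \<bullet> f w"] by blast
  define l where "l = v \<bullet> f v"
  have vW: "v \<in> W" and nv: "v \<bullet> v = 1"
    using v by (auto simp: norm_eq_1)
  have rayleigh: "w \<bullet> f w \<le> l * (w \<bullet> w)" if "w \<in> W" for w
  proof (cases "w = 0")
    case True
    then show ?thesis by simp
  next
    case False
    have "w /\<^sub>R norm w \<in> ?S"
      using that False by (auto intro: subspace_scale[OF W])
    from vmax[OF this] have "(w \<bullet> f w) / (w \<bullet> w) \<le> l"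
      by (simp add: l_def scale divide_simps power2_norm_eq_inner[symmetric] power2_eq_square)
    moreover have "w \<bullet> w > 0"
      using False by simp
    ultimately show ?thesis
      by (simp add: pos_divide_le_eq)
  qed
  define r where "r = f v - l *\<^sub>R v"
  have rW: "r \<in> W"
    unfolding r_def using vW inv by (auto intro!: subspace_diff[OF W] subspace_scale[OF W])
  define c where "c = r \<bullet> f r - l * (r \<bullet> r)"
  have "r \<bullet> r = 0"
  proof (rule ccontr)
    assume "r \<bullet> r \<noteq> 0"
    then have rr: "r \<bullet> r > 0" by simp
    \<comment> \<open>a step so short that the first-order gain \<open>2 * (r \<bullet> r)\<close> outweighs the second-order term \<open>t * c\<close>\<close>
    define t where "t = (r \<bullet> r) / (1 + \<bar>c\<bar>)"
    have t: "t > 0"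
      using rr by (simp add: t_def)
    have "v + t *\<^sub>R r \<in> W"
      using vW rW by (intro subspace_add[OF W] subspace_scale[OF W])
    from rayleigh[OF this]
    have "2 * t * (r \<bullet> f v - l * (r \<bullet> v)) + t * t * c \<le> 0"
      using sa[of r v] nv
      by (simp add: add scale c_def inner_add_left inner_add_right algebra_simps l_def[symmetric]
          inner_commute[of v r] inner_commute[of "f r" v])
    moreover have "r \<bullet> f v - l * (r \<bullet> v) = r \<bullet> r"
      by (simp add: r_def inner_diff_right inner_diff_left)
    ultimately have "t * (2 * (r \<bullet> r) + t * c) \<le> 0"
      by (simp add: algebra_simps)
    then have "2 * (r \<bullet> r) + t * c \<le> 0"
      using t by (simp add: mult_le_0_iff)
    moreover have "- (t * c) \<le> t * \<bar>c\<bar>"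
      using t by (metis abs_ge_minus_self abs_mult abs_of_pos)
    moreover have "t * \<bar>c\<bar> \<le> r \<bullet> r"
      using rr by (simp add: t_def divide_simps mult_left_mono algebra_simps)
    ultimately show False using rr by linarith
  qed
  then have "f v = l *\<^sub>R v"
    by (simp add: r_def)
  moreover have "v \<noteq> 0"
    using nv by auto
  ultimately show ?thesis
    using that vW by blast
qed

text \<open>
  The vectors that are sums of eigenvectors form an invariant subspace. Its orthogonal complement
  is invariant too, because \<open>f\<close> is self-adjoint, so if it were nontrivial it would contain an
  eigenvector, orthogonal to itself. The summands are indexed by their eigenvalues, so that each
  eigenvalue contributes a single term.
\<close>

lemma selfadjoint_eigenvector_decomposition:
  fixes f :: "'a :: euclidean_space \<Rightarrow> 'a"
  assumes lin: "linear f" and sa: "\<And>v w. f v \<bullet> w = v \<bullet> f w"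
  obtains L g where "finite L" "\<And>l. f (g l) = l *\<^sub>R g l" "v = (\<Sum>l\<in>L. g l)"
proof -
  interpret linear f by (rule lin)
  \<comment> \<open>requiring \<open>g\<close> to vanish outside \<open>L\<close> lets decompositions over different index sets be added\<close>
  define D where "D = {v. \<exists>L g. finite L \<and> (\<forall>l. f (g l) = l *\<^sub>R g l) \<and> (\<forall>l. l \<notin> L \<longrightarrow> g l = 0)
    \<and> v = (\<Sum>l\<in>L. g l)}"
  have eig: "v \<in> D" if "f v = l *\<^sub>R v" for v l
    unfolding D_def
    by (rule CollectI, rule exI[of _ "{l}"], rule exI[of _ "\<lambda>k. if k = l then v else 0"])
      (use that in \<open>simp add: zero\<close>)
  have subD: "subspace D"
  proof (rule subspaceI)
    show "0 \<in> D"
      by (rule eig[of 0 0]) (simp add: zero)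
  next
    fix v w assume "v \<in> D" "w \<in> D"
    then obtain L g K h where
      L: "finite L" "\<forall>l. f (g l) = l *\<^sub>R g l" "\<forall>l. l \<notin> L \<longrightarrow> g l = 0" "v = (\<Sum>l\<in>L. g l)" and
      K: "finite K" "\<forall>l. f (h l) = l *\<^sub>R h l" "\<forall>l. l \<notin> K \<longrightarrow> h l = 0" "w = (\<Sum>l\<in>K. h l)"
      unfolding D_def by blast
    have "v = (\<Sum>l\<in>L \<union> K. g l)" "w = (\<Sum>l\<in>L \<union> K. h l)"
      unfolding L(4) K(4) by (rule sum.mono_neutral_left; use L K in auto)+
    then have "v + w = (\<Sum>l\<in>L \<union> K. g l + h l)"
      by (simp add: sum.distrib)
    then show "v + w \<in> D"
      unfolding D_def using L(1-3) K(1-3)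
      by (intro CollectI exI[of _ "L \<union> K"] exI[of _ "\<lambda>l. g l + h l"])
        (simp add: add scaleR_add_right)
  next
    fix c v assume "v \<in> D"
    then obtain L g where
      L: "finite L" "\<forall>l. f (g l) = l *\<^sub>R g l" "\<forall>l. l \<notin> L \<longrightarrow> g l = 0" "v = (\<Sum>l\<in>L. g l)"
      unfolding D_def by blast
    then show "c *\<^sub>R v \<in> D"
      unfolding D_def
      by (intro CollectI exI[of _ L] exI[of _ "\<lambda>l. c *\<^sub>R g l"])
        (simp add: scale scaleR_sum_right)
  qed
  have fD: "f v \<in> D" if vD: "v \<in> D" for v
  proof -
    obtain L g where L: "finite L" "\<forall>l. f (g l) = l *\<^sub>R g l" "v = (\<Sum>l\<in>L. g l)"
      using vD unfolding D_def by blast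
    have "f v = (\<Sum>l\<in>L. l *\<^sub>R g l)"
      using L by (simp add: sum)
    also have "\<dots> \<in> D"
      using L(2) by (intro subspace_sum[OF subD] subspace_scale[OF subD] eig) auto
    finally show ?thesis .
  qed
  have "D\<^sup>\<bottom> = {0}"
  proof (rule ccontr)
    assume nz: "D\<^sup>\<bottom> \<noteq> {0}"
    have "f ` (D\<^sup>\<bottom>) \<subseteq> D\<^sup>\<bottom>"
      using fD by (auto simp: orthogonal_comp_def orthogonal_def sa[symmetric])
    then obtain l v where v: "v \<in> D\<^sup>\<bottom>" "v \<noteq> 0" "f v = l *\<^sub>R v"
      using selfadjoint_eigenvector_in_invariant_subspace[OF lin sa subspace_orthogonal_comp _ nz]
      by blast
    have "v \<in> D"
      using v(3) by (rule eig)
    with v(1) have "v \<bullet> v = 0"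
      by (auto simp: orthogonal_comp_def orthogonal_def)
    with v(2) show False by simp
  qed
  then have "D = UNIV"
    using orthogonal_comp_self[OF subD] by simp
  then have "v \<in> D" by simp
  then show ?thesis
    unfolding D_def using that by blast
qed

text \<open>
  In the expansion of the \<open>t\<close>-th iterate every eigenvector is multiplied by the \<open>t\<close>-th power of its
  eigenvalue. After division by the power of the largest eigenvalue with a nonzero component only
  that component survives; positivity excludes other eigenvalues of the same modulus.
\<close>

lemma power_iteration_converges:
  fixes f :: "'a :: euclidean_space \<Rightarrow> 'a"
  assumes lin: "linear f" and sa: "\<And>v w. f v \<bullet> w = v \<bullet> f w"
    and pos: "\<And>l v. v \<noteq> 0 \<Longrightarrow> f v = l *\<^sub>R v \<Longrightarrow> l > 0"
    and nz: "v \<noteq> 0"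
  obtains l g where "l > 0" "g \<noteq> 0" "(\<lambda>t. (f ^^ t) v /\<^sub>R l ^ t) \<longlonglongrightarrow> g"
proof -
  interpret linear f by (rule lin)
  obtain L g where L: "finite L" "\<And>l. f (g l) = l *\<^sub>R g l" "v = (\<Sum>l\<in>L. g l)"
    using selfadjoint_eigenvector_decomposition[OF lin sa] by metis
  define K where "K = {l \<in> L. g l \<noteq> 0}"
  have K: "finite K" "v = (\<Sum>l\<in>K. g l)"
    using L(1) by (auto simp: K_def L(3) intro: sum.mono_neutral_right)
  have "K \<noteq> {}"
    using K(2) nz by auto
  define m where "m = Max K"
  have m: "m \<in> K" "\<And>l. l \<in> K \<Longrightarrow> l \<le> m"
    using K(1) \<open>K \<noteq> {}\<close> by (auto simp: m_def)
  have Kpos: "l > 0" if "l \<in> K" for l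
    using that pos[of "g l" l] L(2) by (simp add: K_def)
  have iter: "(f ^^ t) v = (\<Sum>l\<in>K. l ^ t *\<^sub>R g l)" for t
  proof (induction t)
    case 0
    then show ?case using K(2) by simp
  next
    case (Suc t)
    then show ?case by (simp add: sum scale L(2) mult.commute)
  qed
  have "(\<lambda>t. \<Sum>l\<in>K. (l / m) ^ t *\<^sub>R g l) \<longlonglongrightarrow> (\<Sum>l\<in>K. if l = m then g m else 0)"
  proof (rule tendsto_sum)
    fix l assume l: "l \<in> K"
    show "(\<lambda>t. (l / m) ^ t *\<^sub>R g l) \<longlonglongrightarrow> (if l = m then g m else 0)"
    proof (cases "l = m")
      case True
      then show ?thesis using Kpos[OF l] by simp
    next
      case False
      then have "(\<lambda>t. (l / m) ^ t) \<longlonglongrightarrow> 0"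
        using Kpos[OF l] m(2)[OF l] by (intro LIMSEQ_realpow_zero) auto
      then show ?thesis
        using False tendsto_scaleR[OF _ tendsto_const, of "\<lambda>t. (l / m) ^ t" 0 sequentially "g l"]
        by simp
    qed
  qed
  moreover have "(\<Sum>l\<in>K. (l / m) ^ t *\<^sub>R g l) = (f ^^ t) v /\<^sub>R m ^ t" for t
    by (simp add: iter scaleR_sum_right power_divide field_simps)
  moreover have "(\<Sum>l\<in>K. if l = m then g m else 0) = g m"
    using K(1) m(1) by (simp add: sum.delta')
  ultimately have "(\<lambda>t. (f ^^ t) v /\<^sub>R m ^ t) \<longlonglongrightarrow> g m"
    by simp
  moreover have "g m \<noteq> 0"
    using m(1) by (simp add: K_def)
  ultimately show ?thesis
    using that Kpos[OF m(1)] by blast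
qed

lemma tendsto_MAX:
  fixes f :: "'i \<Rightarrow> 'a \<Rightarrow> real"
  assumes "finite A" "A \<noteq> {}" "\<And>i. i \<in> A \<Longrightarrow> (f i \<longlongrightarrow> l i) F"
  shows "((\<lambda>t. MAX i\<in>A. f i t) \<longlongrightarrow> (MAX i\<in>A. l i)) F"
  using assms
proof (induction A rule: finite_ne_induct)
  case (singleton i)
  then show ?case by simp
next
  case (insert i A)
  then show ?case by (simp add: tendsto_max)
qed

section \<open>The law of a reversible chain\<close>

lemma law_at_0: "law_at P \<alpha> 0 y = pmf \<alpha> y"
  by (simp add: law_at_def mat_def if_distrib[of "\<lambda>c. _ * c"] cong: if_cong)

lemma law_at_Suc: "law_at P \<alpha> (Suc t) y = (\<Sum>x\<in>UNIV. law_at P \<alpha> t x * P $ x $ y)"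
  unfolding law_at_def matrix_power.simps matrix_matrix_mult_def
  by (simp add: sum_distrib_left sum_distrib_right mult.assoc) (rule sum.swap)

lemma sum_pmf_UNIV: "(\<Sum>x\<in>UNIV. pmf p x) = 1" for p :: "'s :: finite pmf"
  by (rule sum_pmf_eq_1) auto

lemma law_at_stationary:
  assumes "stationary_distribution P \<pi>"
  shows "law_at P \<pi> t y = pmf \<pi> y"
  using assms by (induction t arbitrary: y)
    (simp_all add: law_at_0 law_at_Suc stationary_distribution_def)

lemma sum_law_at:
  assumes "transition_matrix P"
  shows "(\<Sum>y\<in>UNIV. law_at P \<alpha> t y) = 1"
proof (induction t)
  case 0
  then show ?case by (simp add: law_at_0 sum_pmf_UNIV)
next
  case (Suc t)
  have "(\<Sum>y\<in>UNIV. law_at P \<alpha> (Suc t) y) = (\<Sum>x\<in>UNIV. \<Sum>y\<in>UNIV. law_at P \<alpha> t x * P $ x $ y)"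
    unfolding law_at_Suc by (rule sum.swap)
  also have "\<dots> = (\<Sum>x\<in>UNIV. law_at P \<alpha> t x)"
    using assms by (simp add: sum_distrib_left[symmetric] transition_matrix_def)
  finally show ?case using Suc by simp
qed

lemma matrix_power_nonneg:
  assumes "transition_matrix P"
  shows "0 \<le> matrix_power P t $ x $ y"
  using assms
  by (induction t arbitrary: y)
    (auto simp: mat_def matrix_matrix_mult_def transition_matrix_def intro!: sum_nonneg)

text \<open>
  Stationarity transports positive mass from any state charged by \<open>\<pi>\<close> to every state that can be
  reached from it.
\<close>

lemma stationary_distribution_pos:
  assumes tm: "transition_matrix P" and irr: "irreducible_chain P"
    and st: "stationary_distribution P \<pi>"
  shows "0 < pmf \<pi> y"
proof -
  obtain x where "x \<in> set_pmf \<pi>"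
    using set_pmf_not_empty[of \<pi>] by blast
  then have x: "0 < pmf \<pi> x"
    by (simp add: pmf_positive)
  obtain t where t: "0 < matrix_power P t $ x $ y"
    using irr by (auto simp: irreducible_chain_def)
  have "0 < pmf \<pi> x * matrix_power P t $ x $ y"
    using x t by simp
  also have "\<dots> \<le> law_at P \<pi> t y"
    unfolding law_at_def by (rule member_le_sum) (auto simp: matrix_power_nonneg[OF tm])
  finally show ?thesis
    by (simp add: law_at_stationary[OF st])
qed

text \<open>
  Conjugating by the diagonal matrix of \<open>sqrt \<pi>\<close> turns self-adjointness for the inner product
  weighted by \<open>\<pi>\<close> into self-adjointness for the standard one. The discrepancy below is the deviation
  from \<open>\<pi>\<close> in the same coordinates, \<open>sqrt \<pi> * (\<mu> / \<pi> - 1)\<close> for a law \<open>\<mu>\<close>.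
\<close>

definition symmetrization :: "real ^ 's ^ 's \<Rightarrow> 's pmf \<Rightarrow> real ^ 's ^ 's" where
  "symmetrization P \<pi> = (\<chi> x y. P $ x $ y * sqrt (pmf \<pi> x) / sqrt (pmf \<pi> y))"

definition discrepancy :: "real ^ 's ^ 's \<Rightarrow> 's pmf \<Rightarrow> 's pmf \<Rightarrow> nat \<Rightarrow> real ^ 's" where
  "discrepancy P \<pi> \<alpha> t = (\<chi> y. (law_at P \<alpha> t y - pmf \<pi> y) / sqrt (pmf \<pi> y))"

lemma symmetrization_symmetric:
  assumes rev: "reversible_wrt P \<pi>" and pos: "\<And>y. 0 < pmf \<pi> y"
  shows "symmetrization P \<pi> $ x $ y = symmetrization P \<pi> $ y $ x"
proof -
  have "P $ x $ y * (sqrt (pmf \<pi> x) * sqrt (pmf \<pi> x)) = P $ y $ x * (sqrt (pmf \<pi> y) * sqrt (pmf \<pi> y))"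
    using rev by (simp add: reversible_wrt_def mult.commute)
  then show ?thesis
    using pos[of x] pos[of y] by (simp add: symmetrization_def frac_eq_eq mult.assoc)
qed

lemma symmetrization_selfadjoint:
  assumes "reversible_wrt P \<pi>" and "\<And>y. 0 < pmf \<pi> y"
  shows "(symmetrization P \<pi> *v v) \<bullet> w = v \<bullet> (symmetrization P \<pi> *v w)"
proof -
  have "transpose (symmetrization P \<pi>) = symmetrization P \<pi>"
    by (simp add: transpose_def vec_eq_iff symmetrization_symmetric[OF assms])
  then show ?thesis
    by (metis dot_lmul_matrix transpose_matrix_vector)
qed

lemma symmetrization_eigenvalue:
  assumes pos: "\<And>y. 0 < pmf \<pi> y"
    and v: "v \<noteq> 0" "symmetrization P \<pi> *v v = l *\<^sub>R v"
  shows "is_eigenvalue P l"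
proof -
  define w where "w = (\<chi> y. v $ y / sqrt (pmf \<pi> y))"
  have "P *v w = l *\<^sub>R w"
  proof (rule vec_eq_iff[THEN iffD2], rule allI)
    fix x
    have "sqrt (pmf \<pi> x) * (P *v w) $ x = (symmetrization P \<pi> *v v) $ x"
      by (simp add: matrix_vector_mult_def w_def symmetrization_def sum_distrib_left mult_ac)
    also have "\<dots> = sqrt (pmf \<pi> x) * (l *\<^sub>R w) $ x"
      using pos[of x] by (simp add: v(2) w_def)
    finally show "(P *v w) $ x = (l *\<^sub>R w) $ x"
      using pos[of x] by simp
  qed
  moreover have "w \<noteq> 0"
  proof
    assume "w = 0"
    have "v $ y = sqrt (pmf \<pi> y) * w $ y" for y
      using pos[of y] by (simp add: w_def)
    with \<open>w = 0\<close> have "v = 0"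
      by (simp add: vec_eq_iff)
    with v(1) show False by simp
  qed
  ultimately show ?thesis
    by (auto simp: is_eigenvalue_def)
qed

text \<open>
  A law is a row vector, multiplied by \<open>P\<close> from the right. In the symmetrized coordinates the
  matrix equals its transpose, so that one step becomes the action of a self-adjoint operator.
\<close>

lemma discrepancy_iterate:
  assumes rev: "reversible_wrt P \<pi>" and pos: "\<And>y. 0 < pmf \<pi> y"
    and st: "stationary_distribution P \<pi>"
  shows "discrepancy P \<pi> \<alpha> t = ((*v) (symmetrization P \<pi>) ^^ t) (discrepancy P \<pi> \<alpha> 0)"
proof (induction t)
  case 0
  then show ?case by simp
next
  case (Suc t)
  have "discrepancy P \<pi> \<alpha> (Suc t) = symmetrization P \<pi> *v discrepancy P \<pi> \<alpha> t"
  proof (rule vec_eq_iff[THEN iffD2], rule allI)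
    fix y
    have "law_at P \<alpha> (Suc t) y - pmf \<pi> y = (\<Sum>x\<in>UNIV. P $ x $ y * (law_at P \<alpha> t x - pmf \<pi> x))"
      using st by (simp add: law_at_Suc stationary_distribution_def right_diff_distrib
          sum_subtractf mult.commute)
    then have "discrepancy P \<pi> \<alpha> (Suc t) $ y
        = (\<Sum>x\<in>UNIV. P $ x $ y * (law_at P \<alpha> t x - pmf \<pi> x) / sqrt (pmf \<pi> y))"
      by (simp add: discrepancy_def sum_divide_distrib)
    also have "\<dots> = (\<Sum>x\<in>UNIV. symmetrization P \<pi> $ x $ y * discrepancy P \<pi> \<alpha> t $ x)"
      using pos by (intro sum.cong refl) (simp add: symmetrization_def discrepancy_def less_imp_neq[symmetric])
    also have "\<dots> = (symmetrization P \<pi> *v discrepancy P \<pi> \<alpha> t) $ y"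
      by (simp add: matrix_vector_mult_def symmetrization_symmetric[OF rev pos, of y])
    finally show "discrepancy P \<pi> \<alpha> (Suc t) $ y = (symmetrization P \<pi> *v discrepancy P \<pi> \<alpha> t) $ y" .
  qed
  then show ?case using Suc by simp
qed

lemma sum_sqrt_discrepancy:
  assumes "transition_matrix P" and pos: "\<And>y. 0 < pmf \<pi> y"
  shows "(\<Sum>y\<in>UNIV. sqrt (pmf \<pi> y) * discrepancy P \<pi> \<alpha> t $ y) = 0"
  using sum_law_at[OF assms(1), of \<alpha> t] sum_pmf_UNIV[of \<pi>] pos
  by (simp add: discrepancy_def sum_subtractf less_imp_neq[symmetric])

lemma separation_discrepancy:
  assumes pos: "\<And>y. 0 < pmf \<pi> y"
  shows "separation P \<pi> \<alpha> t = (MAX y. - discrepancy P \<pi> \<alpha> t $ y / sqrt (pmf \<pi> y))"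
proof -
  have "1 - law_at P \<alpha> t y / pmf \<pi> y = - discrepancy P \<pi> \<alpha> t $ y / sqrt (pmf \<pi> y)" for y
    using pos[of y] by (simp add: discrepancy_def field_simps)
  then show ?thesis
    by (simp add: separation_def)
qed

lemma discrepancy_0_nonzero:
  assumes pos: "\<And>y. 0 < pmf \<pi> y" and "\<alpha> \<noteq> \<pi>"
  shows "discrepancy P \<pi> \<alpha> 0 \<noteq> 0"
proof
  assume "discrepancy P \<pi> \<alpha> 0 = 0"
  moreover have "pmf \<alpha> y - pmf \<pi> y = sqrt (pmf \<pi> y) * discrepancy P \<pi> \<alpha> 0 $ y" for y
    using pos[of y] by (simp add: discrepancy_def law_at_0)
  ultimately have "pmf \<alpha> y = pmf \<pi> y" for y
    by simp
  then have "\<alpha> = \<pi>"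
    by (intro pmf_eqI)
  with \<open>\<alpha> \<noteq> \<pi>\<close> show False by simp
qed

text \<open>
  Both the discrepancy and the separation decay like \<open>l ^ t\<close> for the same \<open>l\<close>, because the
  separation is a maximum of negated, weighted coordinates of the discrepancy. The quotient can
  only fail to converge if the rescaled separation tends to zero, that is, if no coordinate of the
  limit \<open>g\<close> of the rescaled discrepancies is negative. This is ruled out by the
  orthogonality of \<open>g\<close> to \<open>sqrt \<pi>\<close>.
\<close>

lemma discrepancy_over_separation_converges:
  assumes tm: "transition_matrix P" and rev: "reversible_wrt P \<pi>"
    and pos: "\<And>y. 0 < pmf \<pi> y"
    and st: "stationary_distribution P \<pi>"
    and ev: "\<And>l. is_eigenvalue P l \<Longrightarrow> l > 0"
    and ne: "\<alpha> \<noteq> \<pi>"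
  obtains g :: "real ^ 's" where
    "eventually (\<lambda>t. separation P \<pi> \<alpha> t > 0) sequentially"
    "(\<lambda>t. discrepancy P \<pi> \<alpha> t /\<^sub>R separation P \<pi> \<alpha> t) \<longlonglongrightarrow> g"
proof -
  let ?u = "discrepancy P \<pi> \<alpha>"
  have evpos: "l > 0" if "v \<noteq> 0" "symmetrization P \<pi> *v v = l *\<^sub>R v" for l v
    using ev symmetrization_eigenvalue[OF pos that] by blast
  obtain l g where l: "l > 0" and g: "g \<noteq> 0"
    and "(\<lambda>t. ((*v) (symmetrization P \<pi>) ^^ t) (?u 0) /\<^sub>R l ^ t) \<longlonglongrightarrow> g"
    using power_iteration_converges[OF matrix_vector_mul_linear symmetrization_selfadjoint[OF rev pos]
        evpos discrepancy_0_nonzero[OF pos ne, of P]] .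
  then have lim: "(\<lambda>t. ?u t /\<^sub>R l ^ t) \<longlonglongrightarrow> g"
    by (simp only: discrepancy_iterate[OF rev pos st, of \<alpha>, symmetric])
  define m where "m = (MAX y. - g $ y / sqrt (pmf \<pi> y))"
  have mean_g: "(\<Sum>y\<in>UNIV. sqrt (pmf \<pi> y) * g $ y) = 0"
  proof (rule LIMSEQ_unique)
    show "(\<lambda>t. \<Sum>y\<in>UNIV. sqrt (pmf \<pi> y) * (?u t /\<^sub>R l ^ t) $ y)
        \<longlonglongrightarrow> (\<Sum>y\<in>UNIV. sqrt (pmf \<pi> y) * g $ y)"
      by (intro tendsto_sum tendsto_mult tendsto_const tendsto_vec_nth lim)
    have "(\<Sum>y\<in>UNIV. sqrt (pmf \<pi> y) * (?u t /\<^sub>R l ^ t) $ y)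
        = (\<Sum>y\<in>UNIV. sqrt (pmf \<pi> y) * ?u t $ y) / l ^ t" for t
      by (simp add: sum_divide_distrib field_simps)
    then show "(\<lambda>t. \<Sum>y\<in>UNIV. sqrt (pmf \<pi> y) * (?u t /\<^sub>R l ^ t) $ y) \<longlonglongrightarrow> 0"
      by (simp add: sum_sqrt_discrepancy[OF tm pos])
  qed
  have "m > 0"
  proof (rule ccontr)
    assume "\<not> m > 0"
    moreover have "- g $ y / sqrt (pmf \<pi> y) \<le> m" for y
      unfolding m_def by (rule Max_ge) auto
    ultimately have le0: "- g $ y / sqrt (pmf \<pi> y) \<le> 0" for y
      by (meson order_trans not_le)
    have gnn: "g $ y \<ge> 0" for y
      using le0[of y] pos[of y] by (simp add: zero_le_divide_iff)
    then have "sqrt (pmf \<pi> y) * g $ y = 0" for y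
      using mean_g pos by (subst (asm) sum_nonneg_eq_0_iff) auto
    then have "g $ y = 0" for y
      using pos[of y] by (metis less_irrefl mult_eq_0_iff real_sqrt_eq_0_iff)
    then show False
      using g by (simp add: vec_eq_iff)
  qed
  have sep: "separation P \<pi> \<alpha> t / l ^ t = (MAX y. - (?u t /\<^sub>R l ^ t) $ y / sqrt (pmf \<pi> y))" for t
  proof -
    have "separation P \<pi> \<alpha> t / l ^ t = Max ((\<lambda>s. s / l ^ t) ` range (\<lambda>y. - ?u t $ y / sqrt (pmf \<pi> y)))"
      unfolding separation_discrepancy[OF pos] using l
      by (intro mono_Max_commute) (auto simp: mono_def divide_right_mono)
    then show ?thesis
      by (simp add: image_image field_simps)
  qed
  have lim_sep: "(\<lambda>t. separation P \<pi> \<alpha> t / l ^ t) \<longlonglongrightarrow> m"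
    unfolding sep m_def
    by (intro tendsto_MAX tendsto_divide tendsto_minus tendsto_vec_nth lim tendsto_const)
      (use pos in \<open>auto simp: less_imp_neq[symmetric]\<close>)
  have "(\<lambda>t. (?u t /\<^sub>R l ^ t) /\<^sub>R (separation P \<pi> \<alpha> t / l ^ t)) \<longlonglongrightarrow> g /\<^sub>R m"
    using \<open>m > 0\<close> by (intro tendsto_scaleR tendsto_inverse lim lim_sep) auto
  then have "(\<lambda>t. ?u t /\<^sub>R separation P \<pi> \<alpha> t) \<longlonglongrightarrow> g /\<^sub>R m"
    using l by (simp add: field_simps)
  moreover have "eventually (\<lambda>t. separation P \<pi> \<alpha> t > 0) sequentially"
    using order_tendstoD(1)[OF lim_sep \<open>m > 0\<close>]
    by eventually_elim (use l in \<open>simp add: zero_less_divide_iff\<close>)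
  ultimately show ?thesis
    using that by blast
qed

section \<open>Conditioning on a strong stationary time\<close>

text \<open>
  Taking expectations in the one-step conditional law removes the filtration, however much extra
  randomness it carries, and leaves the recursion that defines the powers of \<open>P\<close>.
\<close>

lemma markov_chain_law:
  assumes mc: "markov_chain M F P \<alpha> X"
  shows "\<P>(\<omega> in M. X t \<omega> = y) = law_at P \<alpha> t y"
proof -
  interpret prob_space M
    using mc by (simp add: markov_chain_def)
  have sub: "subalgebra M (F t)" and XF: "X t \<in> F t \<rightarrow>\<^sub>M count_space UNIV" for t
    using mc by (auto simp: markov_chain_def)
  have X[measurable]: "X t \<in> M \<rightarrow>\<^sub>M count_space UNIV" for t
    using measurable_from_subalg[OF sub XF] .
  show ?thesis
  proof (induction t arbitrary: y)
    case 0
    then show ?case using mc by (simp add: markov_chain_def law_at_0)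
  next
    case (Suc t)
    interpret finite_measure_subalgebra M "F t"
      by unfold_locales (rule sub)
    let ?I = "indicator {\<omega> \<in> space M. X (Suc t) \<omega> = y} :: _ \<Rightarrow> real"
    have "\<P>(\<omega> in M. X (Suc t) \<omega> = y) = (\<integral>\<omega>. ?I \<omega> \<partial>M)"
      by simp
    also have "\<dots> = (\<integral>\<omega>. real_cond_exp M (F t) ?I \<omega> \<partial>M)"
      by (rule real_cond_exp_int(2)[symmetric], rule integrable_real_indicator)
        (simp_all add: less_top[symmetric])
    also have "\<dots> = (\<integral>\<omega>. P $ X t \<omega> $ y \<partial>M)"
      using mc by (intro integral_cong_AE) (auto simp: markov_chain_def)
    also have "\<dots> = (\<integral>\<omega>. (\<Sum>x\<in>UNIV. indicator {\<omega> \<in> space M. X t \<omega> = x} \<omega> * P $ x $ y) \<partial>M)"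
      by (intro Bochner_Integration.integral_cong refl)
        (simp add: indicator_def if_distrib[of "\<lambda>c. c * _"] cong: if_cong)
    also have "\<dots> = (\<Sum>x\<in>UNIV. \<P>(\<omega> in M. X t \<omega> = x) * P $ x $ y)"
      by (subst Bochner_Integration.integral_sum)
        (simp_all add: integrable_real_indicator less_top[symmetric])
    also have "\<dots> = law_at P \<alpha> (Suc t) y"
      using Suc by (simp add: law_at_Suc)
    finally show ?case .
  qed
qed

text \<open>
  The strong stationary time fixes the law of \<open>X t\<close> on the event that it has occurred by time
  \<open>t\<close>. The law on the complement is what remains of the full law of \<open>X t\<close>, and the
  complement has probability \<open>separation P \<pi> \<alpha> t\<close> by optimality.
\<close>

lemma conditional_law_given_not_stopped:
  assumes mc: "markov_chain M F P \<alpha> X"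
    and opt: "optimal_strong_stationary_time M F P \<pi> \<alpha> X \<tau>"
    and pos: "\<And>y. 0 < pmf \<pi> y" and sep: "separation P \<pi> \<alpha> t > 0"
  shows "\<P>(\<omega> in M. X t \<omega> = y \<bar> \<tau> \<omega> > enat t)
    = pmf \<pi> y + sqrt (pmf \<pi> y) * (discrepancy P \<pi> \<alpha> t /\<^sub>R separation P \<pi> \<alpha> t) $ y"
proof -
  interpret prob_space M
    using mc by (simp add: markov_chain_def)
  let ?s = "separation P \<pi> \<alpha> t"
  have sub: "subalgebra M (F t)" and XF: "X t \<in> F t \<rightarrow>\<^sub>M count_space UNIV"
    using mc by (auto simp: markov_chain_def)
  have X[measurable]: "X t \<in> M \<rightarrow>\<^sub>M count_space UNIV"
    using measurable_from_subalg[OF sub XF] .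
  have \<tau>[measurable]: "Measurable.pred M (\<lambda>\<omega>. \<tau> \<omega> \<le> enat t)"
    using opt by (intro measurable_from_subalg[OF sub])
      (simp add: optimal_strong_stationary_time_def randomized_stopping_time_def)
  have surv: "\<P>(\<omega> in M. \<tau> \<omega> > enat t) = ?s"
    and stat: "\<P>(\<omega> in M. X t \<omega> = y \<and> \<tau> \<omega> \<le> enat t) = pmf \<pi> y * \<P>(\<omega> in M. \<tau> \<omega> \<le> enat t)"
    using opt by (auto simp: optimal_strong_stationary_time_def)
  have "\<P>(\<omega> in M. \<not> \<tau> \<omega> \<le> enat t) = 1 - \<P>(\<omega> in M. \<tau> \<omega> \<le> enat t)"
    by (rule prob_neg) measurable
  then have stopped: "\<P>(\<omega> in M. \<tau> \<omega> \<le> enat t) = 1 - ?s"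
    using surv by (simp add: not_le)
  have "law_at P \<alpha> t y = \<P>(\<omega> in M. X t \<omega> = y)"
    by (simp add: markov_chain_law[OF mc])
  also have "{\<omega> \<in> space M. X t \<omega> = y} = {\<omega> \<in> space M. X t \<omega> = y \<and> \<tau> \<omega> \<le> enat t}
      \<union> {\<omega> \<in> space M. X t \<omega> = y \<and> \<not> \<tau> \<omega> \<le> enat t}"
    by auto
  also have "prob \<dots> = \<P>(\<omega> in M. X t \<omega> = y \<and> \<tau> \<omega> \<le> enat t) + \<P>(\<omega> in M. X t \<omega> = y \<and> \<not> \<tau> \<omega> \<le> enat t)"
    by (rule finite_measure_Union) (measurable, auto)
  finally have "\<P>(\<omega> in M. X t \<omega> = y \<and> \<tau> \<omega> > enat t) = law_at P \<alpha> t y - pmf \<pi> y * (1 - ?s)"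
    by (simp add: stat stopped not_le)
  then have "\<P>(\<omega> in M. X t \<omega> = y \<bar> \<tau> \<omega> > enat t) = (law_at P \<alpha> t y - pmf \<pi> y * (1 - ?s)) / ?s"
    by (simp add: cond_prob_def surv)
  also have "\<dots> = pmf \<pi> y + (law_at P \<alpha> t y - pmf \<pi> y) / ?s"
    using sep by (simp add: field_simps)
  also have "law_at P \<alpha> t y - pmf \<pi> y = sqrt (pmf \<pi> y) * discrepancy P \<pi> \<alpha> t $ y"
    using pos[of y] by (simp add: discrepancy_def)
  also have "\<dots> / ?s = sqrt (pmf \<pi> y) * (discrepancy P \<pi> \<alpha> t /\<^sub>R ?s) $ y"
    by (simp add: divide_inverse)
  finally show ?thesis .
qed

theorem theorem2p3:
  fixes P :: "real ^ 's ^ 's"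
    and \<pi> \<alpha> :: "'s pmf"
    and M :: "'w measure"
    and F :: "nat \<Rightarrow> 'w measure"
    and X :: "nat \<Rightarrow> 'w \<Rightarrow> 's"
    and \<tau> :: "'w \<Rightarrow> enat"
    and y :: 's
  assumes "transition_matrix P"
    and "irreducible_chain P"
    and "stationary_distribution P \<pi>"
    and "reversible_wrt P \<pi>"
    and "\<And>l. is_eigenvalue P l \<Longrightarrow> l > 0"
    and "\<alpha> \<noteq> \<pi>"
    and "markov_chain M F P \<alpha> X"
    and "optimal_strong_stationary_time M F P \<pi> \<alpha> X \<tau>"
  shows "\<exists>l. (\<lambda>t. \<P>(\<omega> in M. X t \<omega> = y \<bar> \<tau> \<omega> > enat t)) \<longlonglongrightarrow> l"
proof -
  note pos = stationary_distribution_pos[OF assms(1-3)]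
  obtain g where sep: "eventually (\<lambda>t. separation P \<pi> \<alpha> t > 0) sequentially"
    and lim: "(\<lambda>t. discrepancy P \<pi> \<alpha> t /\<^sub>R separation P \<pi> \<alpha> t) \<longlonglongrightarrow> g"
    using discrepancy_over_separation_converges[OF assms(1,4) pos assms(3,5,6)] by blast
  have "(\<lambda>t. pmf \<pi> y + sqrt (pmf \<pi> y) * (discrepancy P \<pi> \<alpha> t /\<^sub>R separation P \<pi> \<alpha> t) $ y)
      \<longlonglongrightarrow> pmf \<pi> y + sqrt (pmf \<pi> y) * g $ y"
    by (intro tendsto_add tendsto_mult tendsto_const tendsto_vec_nth lim)
  moreover have "eventually (\<lambda>t. pmf \<pi> y + sqrt (pmf \<pi> y) *
      (discrepancy P \<pi> \<alpha> t /\<^sub>R separation P \<pi> \<alpha> t) $ y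
      = \<P>(\<omega> in M. X t \<omega> = y \<bar> \<tau> \<omega> > enat t)) sequentially"
    using sep
    by eventually_elim (rule conditional_law_given_not_stopped[OF assms(7,8) pos, symmetric])
  ultimately have "(\<lambda>t. \<P>(\<omega> in M. X t \<omega> = y \<bar> \<tau> \<omega> > enat t))
      \<longlonglongrightarrow> pmf \<pi> y + sqrt (pmf \<pi> y) * g $ y"
    by (rule Lim_transform_eventually)
  then show ?thesis
    by (rule exI)
qed

end
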